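(* Let $f\colon A\to B$ be a surjective homomorphism of skew braces (an extension). Then $f$ is a central extension with respect to the subvariety $\mathsf{Ab}$ of abelian groups of the variety $\mathsf{SKB}$ of skew braces if and only if $[\operatorname{Ker}(f),A]_{\mathsf{Ab}}=0$.
   Context: A skew brace is a triple $(A,+,\circ)$ where $(A,+)$ and $(A,\circ)$ are groups such that $a\circ(b+c)=a\circ b-a+a\circ c$ for all $a,b,c\in A$; the common identity is $0$, and $a'$ denotes the inverse of $a$ in $(A,\circ)$. Put $a*b=-a+a\circ b-b$, $[a,b]_+=a+b-a-b$ and $[a,b]_\circ=a\circ b\circ a'\circ b'$. An ideal of $A$ is a normal subgroup $I$ of $(A,+)$ with $a*x, x*a\in I$ for all $a\in A$, $x\in I$. For an ideal $I$ of $A$, $[I,A]_{\mathsf{Ab}}$ is the subgroup of $(A,+)$ generated by $\{[i,b]_+,\ i*b,\ [i,b]_\circ\mid i\in I,\ b\in A\}$. $\mathsf{Ab}$ is identified with the full subcategory of $\mathsf{SKB}$ consisting of the skew braces whose two operations coincide and are commutative. The inclusion $\mathsf{Ab}\to\mathsf{SKB}$ has a left adjoint, sending $A$ to $A/R(A)$, where $R(A)$ is the subgroup of $(A,+)$ generated by the elements $a*b$ and $a+b-a-b$ for all $a,b\in A$ (it is an ideal, the smallest one whose quotient lies in $\mathsf{Ab}$); $R$ is an endofunctor of $\mathsf{SKB}$, acting on morphisms by restriction. For an extension $f\colon A\to B$, let $A\times_B A=\{(a_1,a_2)\in A\times A\mid f(a_1)=f(a_2)\}$ with first and second projections $s,t\colon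 A\times_B A\to A$. The extension is central with respect to $\mathsf{Ab}$ if $R(s)=R(t)$, i.e. $s$ and $t$ agree on $R(A\times_B A)$. *)

theory Defs
  imports "HOL-Algebra.Algebra"
begin

text \<open>
  A skew brace \<open>(A, +, \<circ>)\<close> is carried by a ring record: the additive group is
  \<^term>\<open>add_monoid A\<close>, with notation \<open>\<oplus>\<close>, \<open>\<ominus>\<close>, \<open>\<zero>\<close>, and the circle operation is the field
  \<open>mult\<close>, with notation \<open>\<otimes>\<close>, \<open>inv\<close>, \<open>\<one>\<close>.  Neither group is assumed commutative, so none of
  the ring locales apply.
\<close>

locale skew_brace =
  additive: group "add_monoid A" + circle: group A
  for A (structure) +
  assumes circ_add:
    "\<lbrakk>a \<in> carrier A; b \<in> carrier A; c \<in> carrier A\<rbrakk>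
      \<Longrightarrow> a \<otimes> (b \<oplus> c) = a \<otimes> b \<ominus> a \<oplus> a \<otimes> c"

definition skew_brace_hom ::
    "('a, 'm) ring_scheme \<Rightarrow> ('b, 'n) ring_scheme \<Rightarrow> ('a \<Rightarrow> 'b) set" where
  "skew_brace_hom A B = hom (add_monoid A) (add_monoid B) \<inter> hom A B"

definition extension ::
    "('a, 'm) ring_scheme \<Rightarrow> ('b, 'n) ring_scheme \<Rightarrow> ('a \<Rightarrow> 'b) \<Rightarrow> bool" where
  "extension A B f \<longleftrightarrow>
     skew_brace A \<and> skew_brace B \<and> f \<in> skew_brace_hom A B \<and> f ` carrier A = carrier B"

definition star :: "('a, 'm) ring_scheme \<Rightarrow> 'a \<Rightarrow> 'a \<Rightarrow> 'a" where
  "star A a b = \<ominus>\<^bsub>A\<^esub> a \<oplus>\<^bsub>A\<^esub> (a \<otimes>\<^bsub>A\<^esub> b) \<ominus>\<^bsub>A\<^esub> b"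

definition add_commutator :: "('a, 'm) ring_scheme \<Rightarrow> 'a \<Rightarrow> 'a \<Rightarrow> 'a" where
  "add_commutator A a b = a \<oplus>\<^bsub>A\<^esub> b \<ominus>\<^bsub>A\<^esub> a \<ominus>\<^bsub>A\<^esub> b"

definition circ_commutator :: "('a, 'm) ring_scheme \<Rightarrow> 'a \<Rightarrow> 'a \<Rightarrow> 'a" where
  "circ_commutator A a b = a \<otimes>\<^bsub>A\<^esub> b \<otimes>\<^bsub>A\<^esub> inv\<^bsub>A\<^esub> a \<otimes>\<^bsub>A\<^esub> inv\<^bsub>A\<^esub> b"

definition skew_brace_ideal :: "'a set \<Rightarrow> ('a, 'm) ring_scheme \<Rightarrow> bool" where
  "skew_brace_ideal I A \<longleftrightarrow>
     I \<lhd> add_monoid A \<and> (\<forall>a\<in>carrier A. \<forall>x\<in>I. star A a x \<in> I \<and> star A x a \<in> I)"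

text \<open>\<open>[I, A]\<^sub>A\<^sub>b\<close>, meaningful when \<open>I\<close> is an ideal of \<open>A\<close>.\<close>

definition Ab_commutator :: "'a set \<Rightarrow> ('a, 'm) ring_scheme \<Rightarrow> 'a set" where
  "Ab_commutator I A = generate (add_monoid A)
     (\<Union>i\<in>I. \<Union>b\<in>carrier A. {add_commutator A i b, star A i b, circ_commutator A i b})"

text \<open>
  The kernel \<open>R\<close> of the reflection onto abelian groups: the carrier of \<open>R(A)\<close>, and \<open>R(h)\<close>
  for a homomorphism \<open>h\<close> with domain \<open>A\<close>.  Since \<^const>\<open>restrict\<close> is
  \<^const>\<open>undefined\<close> outside the given set, equality of two values of
  \<open>Ab_radical_map A\<close> is equality of functions on \<open>R(A)\<close>.
\<close>

definition Ab_radical :: "('a, 'm) ring_scheme \<Rightarrow> 'a set" where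
  "Ab_radical A = generate (add_monoid A)
     (\<Union>a\<in>carrier A. \<Union>b\<in>carrier A. {star A a b, add_commutator A a b})"

definition Ab_radical_map :: "('a, 'm) ring_scheme \<Rightarrow> ('a \<Rightarrow> 'b) \<Rightarrow> 'a \<Rightarrow> 'b" where
  "Ab_radical_map A h = restrict h (Ab_radical A)"

text \<open>The kernel pair \<open>A \<times>\<^sub>B A\<close> of \<open>f\<close>, with operations inherited from the product.\<close>

definition kernel_pair :: "('a, 'm) ring_scheme \<Rightarrow> ('a \<Rightarrow> 'b) \<Rightarrow> ('a \<times> 'a) ring" where
  "kernel_pair A f = (RDirProd A A)
     \<lparr>carrier := {(a\<^sub>1, a\<^sub>2) \<in> carrier A \<times> carrier A. f a\<^sub>1 = f a\<^sub>2}\<rparr>"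

definition Ab_central :: "('a, 'm) ring_scheme \<Rightarrow> ('a \<Rightarrow> 'b) \<Rightarrow> bool" where
  "Ab_central A f \<longleftrightarrow>
     Ab_radical_map (kernel_pair A f) fst = Ab_radical_map (kernel_pair A f) snd"


subsection \<open>Well-definedness\<close>

context skew_brace
begin

lemma one_eq_zero: "\<one> = \<zero>"
proof -
  have z: "\<zero> \<in> carrier A" using additive.one_closed by simp
  have "\<one> \<otimes> (\<zero> \<oplus> \<zero>) = \<one> \<otimes> \<zero> \<ominus> \<one> \<oplus> \<one> \<otimes> \<zero>"
    by (rule circ_add) (use z in auto)
  then have "\<zero> = \<zero> \<oplus> \<ominus> \<one> \<oplus> \<zero>"
    using z additive.l_one[OF additive.one_closed] by (simp add: a_minus_def)
  also have "\<dots> = \<ominus> \<one>"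
    using additive.l_one additive.r_one additive.inv_closed[of \<one>]
    by (simp add: a_inv_def)
  finally show ?thesis
    using additive.inv_inv[of \<one>] additive.inv_one by (simp add: a_inv_def)
qed

lemma star_closed:
  "\<lbrakk>a \<in> carrier A; b \<in> carrier A\<rbrakk> \<Longrightarrow> star A a b \<in> carrier A"
  using additive.inv_closed additive.m_closed
  by (simp add: star_def a_minus_def a_inv_def)

lemma add_commutator_closed:
  "\<lbrakk>a \<in> carrier A; b \<in> carrier A\<rbrakk> \<Longrightarrow> add_commutator A a b \<in> carrier A"
  using additive.inv_closed additive.m_closed
  by (simp add: add_commutator_def a_minus_def a_inv_def)

lemma star_zero:
  assumes "a \<in> carrier A"
  shows "star A a \<zero> = \<zero>" and "star A \<zero> a = \<zero>"
proof -
  have *: "\<ominus> \<zero> = \<zero>" "\<zero> \<in> carrier A" "\<ominus> a \<in> carrier A"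
    "\<ominus> a \<oplus> a = \<zero>" "a \<oplus> \<ominus> a = \<zero>"
    using assms additive.inv_one additive.one_closed additive.inv_closed
      additive.l_inv additive.r_inv
    by (simp_all add: a_inv_def)
  have "a \<otimes> \<zero> = a" "\<zero> \<otimes> a = a"
    using assms circle.r_one circle.l_one by (simp_all flip: one_eq_zero)
  then show "star A a \<zero> = \<zero>" "star A \<zero> a = \<zero>"
    using assms * additive.l_one additive.r_one by (simp_all add: star_def a_minus_def)
qed

end

lemma skew_brace_hom_star:
  assumes "skew_brace A" "skew_brace B" "h \<in> skew_brace_hom A B"
    and "a \<in> carrier A" "b \<in> carrier A"
  shows "h (star A a b) = star B (h a) (h b)"
    and "h (add_commutator A a b) = add_commutator B (h a) (h b)"
proof -
  interpret A: skew_brace A by fact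
  interpret B: skew_brace B by fact
  have add: "h \<in> hom (add_monoid A) (add_monoid B)" and mult: "h \<in> hom A B"
    using assms(3) by (auto simp: skew_brace_hom_def)
  interpret h: group_hom "add_monoid A" "add_monoid B" h
    by unfold_locales (rule add)
  have minus: "h (\<ominus>\<^bsub>A\<^esub> x) = \<ominus>\<^bsub>B\<^esub> h x" if "x \<in> carrier A" for x
    using h.hom_inv that by (simp add: a_inv_def)
  have plus: "h (x \<oplus>\<^bsub>A\<^esub> y) = h x \<oplus>\<^bsub>B\<^esub> h y" if "x \<in> carrier A" "y \<in> carrier A" for x y
    using h.hom_mult that by simp
  have circ: "h (a \<otimes>\<^bsub>A\<^esub> b) = h a \<otimes>\<^bsub>B\<^esub> h b"
    using hom_mult[OF mult] assms by blast
  have [simp]: "\<ominus>\<^bsub>A\<^esub> x \<in> carrier A" if "x \<in> carrier A" for x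
    using A.additive.inv_closed that by (simp add: a_inv_def)
  have [simp]: "x \<oplus>\<^bsub>A\<^esub> y \<in> carrier A" if "x \<in> carrier A" "y \<in> carrier A" for x y
    using A.additive.m_closed that by simp
  show "h (star A a b) = star B (h a) (h b)"
    and "h (add_commutator A a b) = add_commutator B (h a) (h b)"
    using assms(4,5) by (simp_all add: star_def add_commutator_def a_minus_def minus plus circ)
qed

text \<open>\<open>R(h)\<close> takes values in \<open>R(B)\<close>.\<close>

lemma Ab_radical_map_into:
  assumes "skew_brace A" "skew_brace B" "h \<in> skew_brace_hom A B"
  shows "Ab_radical_map A h \<in> Ab_radical A \<rightarrow> Ab_radical B"
proof -
  interpret A: skew_brace A by fact
  interpret B: skew_brace B by fact
  interpret h: group_hom "add_monoid A" "add_monoid B" h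
    by unfold_locales (use assms(3) in \<open>simp add: skew_brace_hom_def\<close>)
  let ?S = "\<Union>a\<in>carrier A. \<Union>b\<in>carrier A. {star A a b, add_commutator A a b}"
  let ?T = "\<Union>a\<in>carrier B. \<Union>b\<in>carrier B. {star B a b, add_commutator B a b}"
  have S: "?S \<subseteq> carrier (add_monoid A)"
    using A.star_closed A.add_commutator_closed by auto
  have closed: "h a \<in> carrier B" if "a \<in> carrier A" for a
    using h.hom_closed that by simp
  have "h ` ?S \<subseteq> ?T"
  proof (rule image_subsetI)
    fix x assume "x \<in> ?S"
    then obtain a b where ab: "a \<in> carrier A" "b \<in> carrier A"
      and "x = star A a b \<or> x = add_commutator A a b"
      by blast
    then have "h x \<in> {star B (h a) (h b), add_commutator B (h a) (h b)}"
      using skew_brace_hom_star[OF assms ab] by (elim disjE) simp_all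
    then show "h x \<in> ?T"
      using closed[OF ab(1)] closed[OF ab(2)] by blast
  qed
  then have "generate (add_monoid B) (h ` ?S) \<subseteq> generate (add_monoid B) ?T"
    by (rule B.additive.mono_generate)
  moreover have "h ` generate (add_monoid A) ?S = generate (add_monoid B) (h ` ?S)"
    using h.generate_img[OF S] by simp
  ultimately have "h ` Ab_radical A \<subseteq> Ab_radical B"
    unfolding Ab_radical_def by (rule ssubst[rotated])
  then show ?thesis
    unfolding Ab_radical_map_def by (intro Pi_I) (metis imageI restrict_apply' subsetD)
qed

lemma skew_brace_ideal_kernel:
  assumes "skew_brace A" "skew_brace B" "h \<in> skew_brace_hom A B"
  shows "skew_brace_ideal (a_kernel A B h) A"
proof -
  interpret A: skew_brace A by fact
  interpret B: skew_brace B by fact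
  interpret h: group_hom "add_monoid A" "add_monoid B" h
    by unfold_locales (use assms(3) in \<open>simp add: skew_brace_hom_def\<close>)
  have "h a \<in> carrier B" if "a \<in> carrier A" for a
    using h.hom_closed that by simp
  then show ?thesis
    using h.normal_kernel skew_brace_hom_star[OF assms] A.star_closed B.star_zero
    by (simp add: skew_brace_ideal_def a_kernel_def') (simp add: kernel_def)
qed

lemma skew_brace_kernel_pair:
  assumes "skew_brace A" "skew_brace B" "h \<in> skew_brace_hom A B"
  shows "skew_brace (kernel_pair A h)"
    and "fst \<in> skew_brace_hom (kernel_pair A h) A"
    and "snd \<in> skew_brace_hom (kernel_pair A h) A"
proof -
  interpret A: skew_brace A by fact
  interpret B: skew_brace B by fact
  have add: "h \<in> hom (add_monoid A) (add_monoid B)" and mult: "h \<in> hom A B"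
    using assms(3) by (auto simp: skew_brace_hom_def)
  interpret h: group_hom "add_monoid A" "add_monoid B" h
    by unfold_locales (rule add)
  interpret m: group_hom A B h
    by unfold_locales (rule mult)
  let ?K = "{(a\<^sub>1, a\<^sub>2) \<in> carrier A \<times> carrier A. h a\<^sub>1 = h a\<^sub>2}"
  let ?P = "kernel_pair A h"
  have P: "carrier ?P = ?K" "\<one>\<^bsub>?P\<^esub> = (\<one>\<^bsub>A\<^esub>, \<one>\<^bsub>A\<^esub>)" "\<zero>\<^bsub>?P\<^esub> = (\<zero>\<^bsub>A\<^esub>, \<zero>\<^bsub>A\<^esub>)"
    "\<And>x y. x \<otimes>\<^bsub>?P\<^esub> y = (fst x \<otimes>\<^bsub>A\<^esub> fst y, snd x \<otimes>\<^bsub>A\<^esub> snd y)"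
    "\<And>x y. x \<oplus>\<^bsub>?P\<^esub> y = (fst x \<oplus>\<^bsub>A\<^esub> fst y, snd x \<oplus>\<^bsub>A\<^esub> snd y)"
    by (auto simp: kernel_pair_def RDirProd_def DirProd_def monoid.defs split: prod.splits)
  have z: "\<zero>\<^bsub>A\<^esub> \<in> carrier A" and i: "\<And>x. x \<in> carrier A \<Longrightarrow> \<ominus>\<^bsub>A\<^esub> x \<in> carrier A"
    and p: "\<And>x y. x \<in> carrier A \<Longrightarrow> y \<in> carrier A \<Longrightarrow> x \<oplus>\<^bsub>A\<^esub> y \<in> carrier A"
    and li: "\<And>x. x \<in> carrier A \<Longrightarrow> \<ominus>\<^bsub>A\<^esub> x \<oplus>\<^bsub>A\<^esub> x = \<zero>\<^bsub>A\<^esub>"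
    and lo: "\<And>x. x \<in> carrier A \<Longrightarrow> \<zero>\<^bsub>A\<^esub> \<oplus>\<^bsub>A\<^esub> x = x"
    and as: "\<And>x y z. \<lbrakk>x \<in> carrier A; y \<in> carrier A; z \<in> carrier A\<rbrakk>
        \<Longrightarrow> x \<oplus>\<^bsub>A\<^esub> y \<oplus>\<^bsub>A\<^esub> z = x \<oplus>\<^bsub>A\<^esub> (y \<oplus>\<^bsub>A\<^esub> z)"
    using A.additive.one_closed A.additive.inv_closed A.additive.m_closed A.additive.l_inv
      A.additive.l_one A.additive.m_assoc
    by (simp_all add: a_inv_def)
  have hp: "h (x \<oplus>\<^bsub>A\<^esub> y) = h x \<oplus>\<^bsub>B\<^esub> h y" if "x \<in> carrier A" "y \<in> carrier A" for x y
    using h.hom_mult that by simp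
  have hm: "h (\<ominus>\<^bsub>A\<^esub> x) = \<ominus>\<^bsub>B\<^esub> h x" if "x \<in> carrier A" for x
    using h.hom_inv that by (simp add: a_inv_def)
  have addP: "group (add_monoid ?P)"
  proof (rule groupI)
    fix x assume "x \<in> carrier (add_monoid ?P)"
    then show "\<exists>y\<in>carrier (add_monoid ?P). y \<otimes>\<^bsub>add_monoid ?P\<^esub> x = \<one>\<^bsub>add_monoid ?P\<^esub>"
      by (intro bexI[of _ "(\<ominus>\<^bsub>A\<^esub> fst x, \<ominus>\<^bsub>A\<^esub> snd x)"]) (auto simp: P i li hm)
  qed (auto simp: P z p lo as hp)
  have multP: "group ?P"
  proof (rule groupI)
    fix x assume "x \<in> carrier ?P"
    then show "\<exists>y\<in>carrier ?P. y \<otimes>\<^bsub>?P\<^esub> x = \<one>\<^bsub>?P\<^esub>"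
      by (intro bexI[of _ "(inv\<^bsub>A\<^esub> fst x, inv\<^bsub>A\<^esub> snd x)"]) (auto simp: P)
  qed (auto simp: P A.circle.m_assoc)
  interpret AP: group "add_monoid ?P" by (rule addP)
  have minus: "\<ominus>\<^bsub>?P\<^esub> x = (\<ominus>\<^bsub>A\<^esub> fst x, \<ominus>\<^bsub>A\<^esub> snd x)" if "x \<in> carrier ?P" for x
    using AP.inv_equality[of "(\<ominus>\<^bsub>A\<^esub> fst x, \<ominus>\<^bsub>A\<^esub> snd x)" x] that
    by (auto simp: P i li hm a_inv_def[of ?P])
  show "skew_brace ?P"
    by (intro skew_brace.intro addP multP skew_brace_axioms.intro)
       (auto simp: a_minus_def minus, auto simp: P A.circ_add a_minus_def)
  show "fst \<in> skew_brace_hom ?P A" "snd \<in> skew_brace_hom ?P A"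
    by (auto simp: skew_brace_hom_def hom_def P)
qed

end

theory Submission
  imports Defs
begin

text \<open>
  Agreement of the two projections on \<open>R(A \<times>\<^sub>B A)\<close> need only be tested on generators.  Testing
  them on the pairs \<open>(i, 0)\<close> and \<open>(b, b)\<close> with \<open>i\<close> in the kernel kills \<open>[i, b]\<^sub>+\<close>, \<open>i * b\<close> and
  \<open>b * i\<close>, so that \<open>i \<circ> b = i + b = b + i = b \<circ> i\<close>.  Conversely, if \<open>[Ker f, A]\<^sub>A\<^sub>b = 0\<close>, then the
  kernel is central for both operations, which coincide when one argument lies in it.  The two
  components of an element of \<open>A \<times>\<^sub>B A\<close> differ by such a central element, and it cancels in
  every \<open>a * b\<close> and every \<open>[a, b]\<^sub>+\<close>.
\<close>

lemma (in group) generate_eq_one_iff: "generate G S = {\<one>} \<longleftrightarrow> S \<subseteq> {\<one>}"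
proof
  show "S \<subseteq> {\<one>}" if "generate G S = {\<one>}"
    using generate.incl[of _ S G] that by blast
  show "generate G S = {\<one>}" if "S \<subseteq> {\<one>}"
    using mono_generate[OF that] generate_one generate.one[of G S] by auto
qed

text \<open>The equalizer of two homomorphisms is a subgroup, so it contains the span of every set
  it contains.\<close>

lemma group_hom_eq_on_generate:
  assumes "group_hom G H g" "group_hom G H h" "S \<subseteq> carrier G"
    and "\<And>x. x \<in> S \<Longrightarrow> g x = h x" and "x \<in> generate G S"
  shows "g x = h x"
proof -
  interpret g: group_hom G H g by fact
  interpret h: group_hom G H h by fact
  note closed = g.G.generate_in_carrier[OF assms(3)]
  show ?thesis
    using assms(5)
  proof induction
    case (inv x)
    then have "x \<in> carrier G"
      using assms(3) by blast
    then show ?case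
      using assms(4)[OF inv] by simp
  qed (use assms(4) closed in auto)
qed

text \<open>The \<open>i\<close> meets its inverse at once, while centrality carries
  \<open>j\<close> to the right until it meets \<open>inv j\<close>. In the additive group of a skew
  brace, with the circle product of \<open>a\<close> and \<open>b\<close> for \<open>c\<close>, the
  right-hand side is \<open>star A a b\<close>.\<close>

lemma (in group) central_cancel_quotient:
  assumes "i \<in> carrier G" "j \<in> carrier G" "a \<in> carrier G" "b \<in> carrier G" "c \<in> carrier G"
    and j: "\<And>x. x \<in> carrier G \<Longrightarrow> j \<otimes> x = x \<otimes> j"
  shows "inv (i \<otimes> a) \<otimes> (i \<otimes> j \<otimes> c) \<otimes> inv (j \<otimes> b) = inv a \<otimes> c \<otimes> inv b"
proof -
  have "inv (i \<otimes> a) \<otimes> (i \<otimes> j \<otimes> c) \<otimes> inv (j \<otimes> b) = inv a \<otimes> (j \<otimes> (c \<otimes> inv b)) \<otimes> inv j"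
    using assms(1-5) by (simp add: inv_mult_group m_assoc flip: m_assoc[of "inv i" i])
  also have "\<dots> = inv a \<otimes> c \<otimes> inv b"
    using assms(1-5) by (simp add: j m_assoc)
  finally show ?thesis .
qed

lemma (in group) central_cancel_commutator:
  assumes "i \<in> carrier G" "j \<in> carrier G" "a \<in> carrier G" "b \<in> carrier G"
    and i: "\<And>x. x \<in> carrier G \<Longrightarrow> i \<otimes> x = x \<otimes> i"
    and j: "\<And>x. x \<in> carrier G \<Longrightarrow> j \<otimes> x = x \<otimes> j"
  shows "i \<otimes> a \<otimes> (j \<otimes> b) \<otimes> inv (i \<otimes> a) \<otimes> inv (j \<otimes> b) = a \<otimes> b \<otimes> inv a \<otimes> inv b"
proof -
  have "i \<otimes> a \<otimes> (j \<otimes> b) \<otimes> inv (i \<otimes> a) \<otimes> inv (j \<otimes> b)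
      = (i \<otimes> (a \<otimes> (j \<otimes> (b \<otimes> inv a)))) \<otimes> inv i \<otimes> (inv b \<otimes> inv j)"
    using assms(1-4) by (simp add: inv_mult_group m_assoc)
  also have "\<dots> = a \<otimes> (j \<otimes> (b \<otimes> inv a \<otimes> inv b)) \<otimes> inv j"
    using assms(1-4) by (simp add: i m_assoc)
  also have "\<dots> = a \<otimes> b \<otimes> inv a \<otimes> inv b"
    using assms(1-4) by (simp add: j m_assoc)
  finally show ?thesis .
qed

text \<open>The commutator is the quotient of \<open>a \<otimes> b\<close> by
  \<open>b \<otimes> a\<close>. The fact is used for both groups of a skew brace.\<close>

lemma (in group) commutator_eq_one_iff:
  assumes "a \<in> carrier G" "b \<in> carrier G"
  shows "a \<otimes> b \<otimes> inv a \<otimes> inv b = \<one> \<longleftrightarrow> a \<otimes> b = b \<otimes> a"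
proof -
  have "a \<otimes> b \<otimes> inv a \<otimes> inv b = (a \<otimes> b) \<otimes> inv (b \<otimes> a)"
    using assms by (simp add: inv_mult_group m_assoc)
  then show ?thesis
    using assms inv_solve_right'[of \<one> "a \<otimes> b" "b \<otimes> a"] by auto
qed

context skew_brace
begin

lemma zero_closed: "\<zero> \<in> carrier A"
  using additive.one_closed by simp

lemma zero_add: "a \<in> carrier A \<Longrightarrow> \<zero> \<oplus> a = a"
  using additive.l_one by simp

lemma add_closed: "\<lbrakk>a \<in> carrier A; b \<in> carrier A\<rbrakk> \<Longrightarrow> a \<oplus> b \<in> carrier A"
  using additive.m_closed by simp

lemma star_eq_zero_iff:
  assumes "a \<in> carrier A" "b \<in> carrier A"
  shows "star A a b = \<zero> \<longleftrightarrow> a \<otimes> b = a \<oplus> b"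
proof -
  have "star A a b = \<zero> \<longleftrightarrow> (\<ominus> a \<oplus> a \<otimes> b) \<oplus> \<ominus> b = \<zero>"
    by (simp add: star_def a_minus_def)
  also have "\<dots> \<longleftrightarrow> \<ominus> a \<oplus> a \<otimes> b = b"
    using assms additive.inv_solve_right'[of \<zero> "\<ominus> a \<oplus> a \<otimes> b" b] additive.inv_closed[of a]
      additive.m_closed[of "\<ominus> a" "a \<otimes> b"] zero_closed zero_add
    by (auto simp: a_inv_def)
  also have "\<dots> \<longleftrightarrow> a \<otimes> b = a \<oplus> b"
    using assms additive.inv_solve_left'[of b a "a \<otimes> b"] by (auto simp: a_inv_def)
  finally show ?thesis .
qed

lemma add_commutator_eq_zero_iff:
  "\<lbrakk>a \<in> carrier A; b \<in> carrier A\<rbrakk> \<Longrightarrow> add_commutator A a b = \<zero> \<longleftrightarrow> a \<oplus> b = b \<oplus> a"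
  using additive.commutator_eq_one_iff[of a b]
  by (simp add: add_commutator_def a_minus_def a_inv_def)

lemma circ_commutator_eq_zero_iff:
  "\<lbrakk>a \<in> carrier A; b \<in> carrier A\<rbrakk> \<Longrightarrow> circ_commutator A a b = \<zero> \<longleftrightarrow> a \<otimes> b = b \<otimes> a"
  using circle.commutator_eq_one_iff[of a b] by (simp add: circ_commutator_def one_eq_zero)

lemma add_commutator_zero: "a \<in> carrier A \<Longrightarrow> add_commutator A \<zero> a = \<zero>"
  using additive.l_one additive.r_one zero_closed by (simp add: add_commutator_eq_zero_iff)

text \<open>A generated subgroup is trivial exactly when all its generators are, and each of the
  three kinds of generators vanishes exactly when one of the three equations holds.\<close>

lemma Ab_commutator_eq_zero_iff:
  assumes "I \<subseteq> carrier A"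
  shows "Ab_commutator I A = {\<zero>} \<longleftrightarrow>
    (\<forall>i\<in>I. \<forall>b\<in>carrier A. i \<oplus> b = b \<oplus> i \<and> i \<otimes> b = i \<oplus> b \<and> i \<otimes> b = b \<otimes> i)"
proof -
  have "Ab_commutator I A = {\<zero>} \<longleftrightarrow> (\<forall>i\<in>I. \<forall>b\<in>carrier A.
      add_commutator A i b = \<zero> \<and> star A i b = \<zero> \<and> circ_commutator A i b = \<zero>)"
    using additive.generate_eq_one_iff unfolding Ab_commutator_def by simp blast
  also have "\<dots> \<longleftrightarrow>
      (\<forall>i\<in>I. \<forall>b\<in>carrier A. i \<oplus> b = b \<oplus> i \<and> i \<otimes> b = i \<oplus> b \<and> i \<otimes> b = b \<otimes> i)"
    using assms add_commutator_eq_zero_iff star_eq_zero_iff circ_commutator_eq_zero_iff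
    by (intro ball_cong refl conj_cong) auto
  finally show ?thesis .
qed

text \<open>Central summands can be pulled out of a circle product, where they contribute
  \<open>i \<oplus> j\<close>; what remains is a cancellation in the additive group. Centrality is
  asked of three elements only, so no ideal has to be mentioned.\<close>

lemma central_cancel:
  assumes I: "i \<in> carrier A" "j \<in> carrier A" "i \<oplus> j \<in> carrier A"
    and ab: "a \<in> carrier A" "b \<in> carrier A"
    and central: "\<And>k b. k \<in> {i, j, i \<oplus> j} \<Longrightarrow> b \<in> carrier A \<Longrightarrow>
      k \<oplus> b = b \<oplus> k \<and> k \<otimes> b = k \<oplus> b \<and> k \<otimes> b = b \<otimes> k"
  shows "star A (i \<oplus> a) (j \<oplus> b) = star A a b"
    and "add_commutator A (i \<oplus> a) (j \<oplus> b) = add_commutator A a b"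
proof -
  have comm: "\<forall>x\<in>carrier A. i \<oplus> x = x \<oplus> i" "\<forall>x\<in>carrier A. j \<oplus> x = x \<oplus> j"
    using central by blast+
  \<comment> \<open>Sums with \<open>i\<close> or \<open>j\<close> are circle products, so
    associativity in the circle group replaces the skew distributive law.\<close>
  have "(i \<oplus> a) \<otimes> (j \<oplus> b) = i \<otimes> a \<otimes> (j \<otimes> b)"
    using central I ab by simp
  also have "\<dots> = i \<otimes> (a \<otimes> j) \<otimes> b"
    using I ab by (simp add: circle.m_assoc)
  also have "a \<otimes> j = j \<otimes> a"
    using central[of j a] ab by (metis insertI1 insertI2)
  also have "i \<otimes> (j \<otimes> a) \<otimes> b = (i \<otimes> j) \<otimes> (a \<otimes> b)"
    using I ab by (simp add: circle.m_assoc)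
  \<comment> \<open>Back to sums: first \<open>i \<otimes> j\<close> becomes
    \<open>i \<oplus> j\<close>, and then this sum must itself be central to be split off from
    \<open>a \<otimes> b\<close>.\<close>
  also have "\<dots> = i \<oplus> j \<oplus> a \<otimes> b"
    using central[of i j] central[of "i \<oplus> j" "a \<otimes> b"] I ab by simp
  finally have circ: "(i \<oplus> a) \<otimes> (j \<oplus> b) = i \<oplus> j \<oplus> a \<otimes> b" .
  show "star A (i \<oplus> a) (j \<oplus> b) = star A a b"
    unfolding star_def a_minus_def a_inv_def circ
    using additive.central_cancel_quotient[of i j a b "a \<otimes> b",
        unfolded monoid.simps partial_object.simps, OF I(1,2) ab circle.m_closed[OF ab]]
      comm(2)
    by blast
  show "add_commutator A (i \<oplus> a) (j \<oplus> b) = add_commutator A a b"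
    unfolding add_commutator_def a_minus_def a_inv_def
    using additive.central_cancel_commutator[of i j a b,
        unfolded monoid.simps partial_object.simps, OF I(1,2) ab] comm
    by blast
qed

end

text \<open>Both projections are homomorphisms of skew braces, so their values on a generator of the
  radical of the kernel pair are the same expressions formed in each component. This removes the
  radical from the centrality condition.\<close>

lemma Ab_central_iff:
  assumes "skew_brace A" "skew_brace B" "f \<in> skew_brace_hom A B"
  shows "Ab_central A f \<longleftrightarrow>
    (\<forall>x\<in>carrier (kernel_pair A f). \<forall>y\<in>carrier (kernel_pair A f).
      star A (fst x) (fst y) = star A (snd x) (snd y) \<and>
      add_commutator A (fst x) (fst y) = add_commutator A (snd x) (snd y))"
    (is "_ \<longleftrightarrow> ?R")
proof -
  let ?P = "kernel_pair A f"
  let ?S = "\<Union>a\<in>carrier ?P. \<Union>b\<in>carrier ?P. {star ?P a b, add_commutator ?P a b}"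
  note P = skew_brace_kernel_pair[OF assms]
  interpret A: skew_brace A by fact
  interpret P: skew_brace ?P by (rule P)
  note hom_fst = skew_brace_hom_star[OF P(1) assms(1) P(2)]
    and hom_snd = skew_brace_hom_star[OF P(1) assms(1) P(3)]
  have group_hom: "group_hom (add_monoid ?P) (add_monoid A) fst"
    "group_hom (add_monoid ?P) (add_monoid A) snd"
    using P(2,3) by unfold_locales (simp_all add: skew_brace_hom_def)
  have S: "?S \<subseteq> carrier (add_monoid ?P)"
    using P.star_closed P.add_commutator_closed by auto
  \<comment> \<open>Outside the radical both restrictions are \<open>undefined\<close>, so equality
    of the functions only concerns the radical.\<close>
  have "Ab_central A f \<longleftrightarrow> (\<forall>x\<in>generate (add_monoid ?P) ?S. fst x = snd x)"
    unfolding Ab_central_def Ab_radical_map_def Ab_radical_def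
    by (simp add: fun_eq_iff restrict_def Ball_def)
  also have "\<dots> \<longleftrightarrow> (\<forall>x\<in>?S. fst x = snd x)"
  proof (intro iffI ballI)
    fix x assume "\<forall>x\<in>generate (add_monoid ?P) ?S. fst x = snd x" and "x \<in> ?S"
    then show "fst x = snd x"
      by (rule bspec[OF _ generate.incl])
  next
    fix x assume eq: "\<forall>x\<in>?S. fst x = snd x" and "x \<in> generate (add_monoid ?P) ?S"
    then show "fst x = snd x"
      by (intro group_hom_eq_on_generate[OF group_hom S bspec[OF eq]])
  qed
  also have "\<dots> \<longleftrightarrow> ?R"
    using hom_fst hom_snd by simp
  finally show ?thesis .
qed

theorem proposition5p4:
  fixes A :: "('a, 'm) ring_scheme" and B :: "('b, 'n) ring_scheme" and f :: "'a \<Rightarrow> 'b"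
  assumes "extension A B f"
  shows "Ab_central A f \<longleftrightarrow> Ab_commutator (a_kernel A B f) A = {\<zero>\<^bsub>A\<^esub>}"
proof -
  have ext: "skew_brace A" "skew_brace B" "f \<in> skew_brace_hom A B"
    using assms by (auto simp: extension_def)
  interpret A: skew_brace A by fact
  interpret B: skew_brace B by fact
  interpret f: group_hom "add_monoid A" "add_monoid B" f
    by unfold_locales (use ext(3) in \<open>simp add: skew_brace_hom_def\<close>)
  let ?I = "a_kernel A B f" and ?P = "kernel_pair A f"
  have P: "(a, b) \<in> carrier ?P \<longleftrightarrow> a \<in> carrier A \<and> b \<in> carrier A \<and> f a = f b" for a b
    by (simp add: kernel_pair_def)
  have I: "i \<in> ?I \<longleftrightarrow> i \<in> carrier A \<and> f i = \<zero>\<^bsub>B\<^esub>" for i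
    by (simp add: a_kernel_def')
  have f_zero: "f \<zero>\<^bsub>A\<^esub> = \<zero>\<^bsub>B\<^esub>"
    using f.hom_one by simp
  have I_add: "i \<oplus>\<^bsub>A\<^esub> j \<in> ?I" if "i \<in> ?I" "j \<in> ?I" for i j
    using that f.hom_mult[of i j] A.add_closed B.zero_add B.zero_closed by (simp add: I)
  have I_carrier: "?I \<subseteq> carrier A"
    using I by blast
  note central_iff = Ab_central_iff[OF ext] and comm_iff = A.Ab_commutator_eq_zero_iff[OF I_carrier]
  show ?thesis
  proof
    assume "Ab_central A f"
    then have eq: "star A a c = star A b d \<and> add_commutator A a c = add_commutator A b d"
      if "(a, b) \<in> carrier ?P" "(c, d) \<in> carrier ?P" for a b c d
      using that unfolding central_iff by fastforce
    have "i \<oplus>\<^bsub>A\<^esub> b = b \<oplus>\<^bsub>A\<^esub> i \<and> i \<otimes>\<^bsub>A\<^esub> b = i \<oplus>\<^bsub>A\<^esub> b \<and> i \<otimes>\<^bsub>A\<^esub> b = b \<otimes>\<^bsub>A\<^esub> i"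
      if "i \<in> ?I" and b: "b \<in> carrier A" for i b
    proof -
      have i: "i \<in> carrier A" and iP: "(i, \<zero>\<^bsub>A\<^esub>) \<in> carrier ?P" and bP: "(b, b) \<in> carrier ?P"
        using that by (simp_all add: I P f_zero A.zero_closed)
      \<comment> \<open>Since \<open>i\<close> is paired with zero, the second components are
        expressions with a zero argument and vanish. The two orders of the pairs give
        \<open>star A i b\<close> and \<open>star A b i\<close>; the latter is what turns additive
        commutation into circle commutation.\<close>
      have "star A i b = \<zero>\<^bsub>A\<^esub>" "add_commutator A i b = \<zero>\<^bsub>A\<^esub>" "star A b i = \<zero>\<^bsub>A\<^esub>"
        using eq[OF iP bP] eq[OF bP iP] b by (simp_all add: A.star_zero A.add_commutator_zero)
      then show ?thesis
        using i b by (simp add: A.star_eq_zero_iff A.add_commutator_eq_zero_iff)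
    qed
    then show "Ab_commutator ?I A = {\<zero>\<^bsub>A\<^esub>}"
      unfolding comm_iff by blast
  next
    assume "Ab_commutator ?I A = {\<zero>\<^bsub>A\<^esub>}"
    then have central: "k \<oplus>\<^bsub>A\<^esub> b = b \<oplus>\<^bsub>A\<^esub> k \<and> k \<otimes>\<^bsub>A\<^esub> b = k \<oplus>\<^bsub>A\<^esub> b \<and> k \<otimes>\<^bsub>A\<^esub> b = b \<otimes>\<^bsub>A\<^esub> k"
      if "k \<in> ?I" "b \<in> carrier A" for k b
      using that unfolding comm_iff by blast
    have decompose: "\<exists>i\<in>?I. a = i \<oplus>\<^bsub>A\<^esub> b" if "(a, b) \<in> carrier ?P" for a b
    proof
      have ab: "a \<in> carrier A" "b \<in> carrier A" "f a = f b"
        using that by (simp_all add: P)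
      have minus: "\<ominus>\<^bsub>A\<^esub> b \<in> carrier A" "f (\<ominus>\<^bsub>A\<^esub> b) = \<ominus>\<^bsub>B\<^esub> f b"
        using ab f.hom_inv A.additive.inv_closed by (simp_all add: a_inv_def)
      \<comment> \<open>As addition need not commute, the difference is taken with \<open>b\<close>
        on the right, to match \<open>i\<close> standing on the left of \<open>b\<close>.\<close>
      show "a \<ominus>\<^bsub>A\<^esub> b \<in> ?I"
        using ab minus f.hom_mult[of a "\<ominus>\<^bsub>A\<^esub> b"] A.add_closed B.additive.r_inv f.hom_closed
        by (simp add: I a_minus_def a_inv_def[of B])
      show "a = a \<ominus>\<^bsub>A\<^esub> b \<oplus>\<^bsub>A\<^esub> b"
        using ab A.additive.inv_solve_right[of "a \<ominus>\<^bsub>A\<^esub> b" a b] minus A.add_closed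
        by (simp add: a_minus_def a_inv_def)
    qed
    show "Ab_central A f"
      unfolding central_iff
    proof (intro ballI)
      fix x y
      assume "x \<in> carrier ?P" "y \<in> carrier ?P"
      then obtain a a' b b' where x: "x = (a, a')" and y: "y = (b, b')"
        and aP: "(a, a') \<in> carrier ?P" and bP: "(b, b') \<in> carrier ?P"
        by (metis surj_pair)
      obtain i j where ij: "i \<in> ?I" "j \<in> ?I" and ab: "a = i \<oplus>\<^bsub>A\<^esub> a'" "b = j \<oplus>\<^bsub>A\<^esub> b'"
        using decompose[OF aP] decompose[OF bP] by blast
      \<comment> \<open>The kernel is closed under addition, which supplies the third central
        element for \<open>A.central_cancel\<close>.\<close>
      have "{i, j, i \<oplus>\<^bsub>A\<^esub> j} \<subseteq> ?I"
        using ij I_add by blast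
      then have comm: "k \<oplus>\<^bsub>A\<^esub> c = c \<oplus>\<^bsub>A\<^esub> k \<and> k \<otimes>\<^bsub>A\<^esub> c = k \<oplus>\<^bsub>A\<^esub> c \<and> k \<otimes>\<^bsub>A\<^esub> c = c \<otimes>\<^bsub>A\<^esub> k"
        if "k \<in> {i, j, i \<oplus>\<^bsub>A\<^esub> j}" "c \<in> carrier A" for k c
        using central that by blast
      have "i \<in> carrier A" "j \<in> carrier A" "i \<oplus>\<^bsub>A\<^esub> j \<in> carrier A"
        "a' \<in> carrier A" "b' \<in> carrier A"
        using ij aP bP A.add_closed by (simp_all add: I P)
      then show "star A (fst x) (fst y) = star A (snd x) (snd y) \<and>
          add_commutator A (fst x) (fst y) = add_commutator A (snd x) (snd y)"
        unfolding x y ab fst_conv snd_conv using A.central_cancel[of i j a' b'] comm by blast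
    qed
  qed
qed

end
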